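(* Let $X$ be a real vector space and $\Phi$ a symmetric set of elementary functions on $X$ (i.e. $\Phi=-\Phi$). Let $f,g:X\to(-\infty,+\infty]$ be proper $\Phi$-convex functions with $\operatorname{dom} f\cap\operatorname{dom} g\neq\emptyset$. Let $x^*\in X$ and $\varphi^*\in\Phi$. The following conditions are equivalent: (i) $$\inf_{x\in X}(f(x)+g(x))=f(x^* )+g(x^* )=\sup_{\varphi\in\Phi}\bigl(-f_\Phi^*(-\varphi)-g_\Phi^*(\varphi)\bigr)=-f_\Phi^*(-\varphi^* )-g_\Phi^*(\varphi^* );$$ (ii) $x^*$ and $\varphi^*$ satisfy the $\Phi$-Karush-Kuhn-Tucker conditions $$-\varphi^*\in\partial_\Phi f(x^* ),\qquad x^*\in\partial_X g_\Phi^*(\varphi^* ).$$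
   Context: A set of elementary functions $\Phi$ on $X$ is a set of real-valued functions $\varphi:X\to\mathbb{R}$ closed under addition of real constants; $-\Phi=\{-\varphi:\varphi\in\Phi\}$. A function $h:X\to(-\infty,+\infty]$ is proper if $\operatorname{dom} h=\{x: h(x)<+\infty\}\ne\emptyset$, and is $\Phi$-convex if $h(x)=\sup\{\varphi(x):\varphi\in\Phi,\ \varphi\le h \text{ on } X\}$ for all $x\in X$. $\Phi$-conjugate: $h_\Phi^*(\varphi)=\sup_{x\in X}(\varphi(x)-h(x))$ for $\varphi\in\Phi$. $\Phi$-subgradients: for $\bar x\in\operatorname{dom} h$, $\partial_\Phi h(\bar x)=\{\varphi\in\Phi: h(x)-h(\bar x)\ge\varphi(x)-\varphi(\bar x)\ \forall x\in X\}$ (empty if $\bar x\notin\operatorname{dom} h$). For $\bar\varphi\in\Phi$ with $h_\Phi^*(\bar\varphi)<+\infty$ and $\bar x\in X$, $\bar x\in\partial_X h_\Phi^*(\bar\varphi)$ means $h_\Phi^*(\varphi)-h_\Phi^*(\bar\varphi)\ge\varphi(\bar x)-\bar\varphi(\bar x)$ for all $\varphi\in\Phi$ ($\partial_X h_\Phi^*(\bar\varphi)$ is empty if $h_\Phi^*(\bar\varphi)=+\infty$). *)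

theory Defs
  imports Complex_Main "HOL-Library.Extended_Real"
begin

definition elementary_functions :: "('a \<Rightarrow> real) set \<Rightarrow> bool" where
  "elementary_functions \<Phi> \<longleftrightarrow> (\<forall>\<phi>\<in>\<Phi>. \<forall>c::real. (\<lambda>x. \<phi> x + c) \<in> \<Phi>)"

text \<open>The set of negated functions is written as an image, since unary minus on a set
  is its complement.\<close>

definition symmetric_functions :: "('a \<Rightarrow> real) set \<Rightarrow> bool" where
  "symmetric_functions \<Phi> \<longleftrightarrow> \<Phi> = uminus ` \<Phi>"

text \<open>Functions into \<open>(-\<infinity>, +\<infinity>]\<close> are \<^typ>\<open>ereal\<close>-valued functions that omit the value
  \<open>-\<infinity>\<close>; this is a condition separate from properness.\<close>

definition omits_minus_infinity :: "('a \<Rightarrow> ereal) \<Rightarrow> bool" where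
  "omits_minus_infinity h \<longleftrightarrow> (\<forall>x. h x \<noteq> -\<infinity>)"

definition effective_domain :: "('a \<Rightarrow> ereal) \<Rightarrow> 'a set" where
  "effective_domain h = {x. h x < \<infinity>}"

definition proper_function :: "('a \<Rightarrow> ereal) \<Rightarrow> bool" where
  "proper_function h \<longleftrightarrow> effective_domain h \<noteq> {}"

text \<open>If \<open>\<Phi>\<close> contains no minorant of \<open>h\<close>, the supremum is over the empty set, i.e. \<open>-\<infinity>\<close>.\<close>

definition phi_convex :: "('a \<Rightarrow> real) set \<Rightarrow> ('a \<Rightarrow> ereal) \<Rightarrow> bool" where
  "phi_convex \<Phi> h \<longleftrightarrow>
     (\<forall>x. h x = (SUP \<phi>\<in>{\<phi>\<in>\<Phi>. \<forall>y. ereal (\<phi> y) \<le> h y}. ereal (\<phi> x)))"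

text \<open>The class \<open>\<Phi>\<close> enters the conjugate only as the range of its argument, so it is not a
  parameter here.\<close>

definition phi_conjugate :: "('a \<Rightarrow> ereal) \<Rightarrow> ('a \<Rightarrow> real) \<Rightarrow> ereal" where
  "phi_conjugate h \<phi> = (SUP x. ereal (\<phi> x) - h x)"

definition phi_subdifferential ::
    "('a \<Rightarrow> real) set \<Rightarrow> ('a \<Rightarrow> ereal) \<Rightarrow> 'a \<Rightarrow> ('a \<Rightarrow> real) set" where
  "phi_subdifferential \<Phi> h xb =
     {\<phi>\<in>\<Phi>. xb \<in> effective_domain h \<and> (\<forall>x. h x - h xb \<ge> ereal (\<phi> x - \<phi> xb))}"

definition conjugate_subdifferential ::
    "('a \<Rightarrow> real) set \<Rightarrow> ('a \<Rightarrow> ereal) \<Rightarrow> ('a \<Rightarrow> real) \<Rightarrow> 'a set" where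
  "conjugate_subdifferential \<Phi> h \<phi>b =
     {xb. phi_conjugate h \<phi>b < \<infinity> \<and>
          (\<forall>\<phi>\<in>\<Phi>. phi_conjugate h \<phi> - phi_conjugate h \<phi>b \<ge> ereal (\<phi> xb - \<phi>b xb))}"

end

theory Submission
  imports Defs
begin

text \<open>Both conditions say that the Fenchel--Young inequality \<open>\<phi> x \<le> h x + h\<^sup>* \<phi>\<close> is an equality
  for \<open>(f, - \<phi>\<^sup>*)\<close> and for \<open>(g, \<phi>\<^sup>*)\<close> at \<open>x\<^sup>*\<close>. Adding the two inequalities gives weak duality, so a
  zero duality gap attained at \<open>(x\<^sup>*, \<phi>\<^sup>*)\<close> forces equality in each. For \<open>f\<close>, equality is the
  subgradient condition; for \<open>g\<close>, the condition on the conjugate yields equality because \<open>g\<close>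
  is the supremum of its minorants in \<open>\<Phi>\<close>, which have nonpositive conjugate.\<close>

lemma fenchel_young: "ereal (\<phi> x) - h x \<le> phi_conjugate h \<phi>"
  unfolding phi_conjugate_def by (rule SUP_upper) simp

text \<open>A point where \<open>h\<close> is below \<infinity> already contributes a term above
  -\<infinity> to the supremum. This keeps the later case splits clear of indeterminate
  sums.\<close>

lemma phi_conjugate_not_MInf:
  assumes "proper_function h"
  shows "phi_conjugate h \<phi> \<noteq> -\<infinity>"
proof -
  obtain x where "h x < \<infinity>"
    using assms unfolding proper_function_def effective_domain_def by blast
  then show ?thesis
    using fenchel_young[of \<phi> x h] by (cases "h x") auto
qed

text \<open>In the sum of the two Fenchel-Young inequalities the values of \<open>- \<phi>\<close>
  and \<open>\<phi>\<close> at \<open>x\<close> cancel. If a conjugate is \<infinity>, the left side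
  is -\<infinity>; if \<open>f x\<close> or \<open>g x\<close> is \<infinity>, so is the right
  side.\<close>

lemma weak_duality:
  assumes "omits_minus_infinity f" "omits_minus_infinity g"
    and "proper_function f" "proper_function g"
  shows "- phi_conjugate f (- \<phi>) - phi_conjugate g \<phi> \<le> f x + g x"
proof -
  have "f x \<noteq> -\<infinity>" "g x \<noteq> -\<infinity>"
    using assms unfolding omits_minus_infinity_def by auto
  moreover note phi_conjugate_not_MInf[OF assms(3), of "- \<phi>"]
    phi_conjugate_not_MInf[OF assms(4), of \<phi>]
  moreover note fenchel_young[of "- \<phi>" x f] fenchel_young[of \<phi> x g]
  ultimately show ?thesis
    by (cases "f x"; cases "g x"; cases "phi_conjugate f (- \<phi>)"; cases "phi_conjugate g \<phi>")
      auto
qed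

text \<open>At a point where \<open>h x\<close> is finite, the subgradient inequality rearranges to
  say that \<open>x\<close> attains the supremum defining the conjugate.\<close>

lemma phi_subdifferential_iff:
  assumes "omits_minus_infinity h"
  shows "\<phi> \<in> phi_subdifferential \<Phi> h x \<longleftrightarrow>
    \<phi> \<in> \<Phi> \<and> h x < \<infinity> \<and> phi_conjugate h \<phi> = ereal (\<phi> x) - h x"
proof (cases "h x < \<infinity>")
  case True
  then obtain r where r: "h x = ereal r"
    using assms unfolding omits_minus_infinity_def by (cases "h x") auto
  \<comment> \<open>If \<open>h y\<close> is \<infinity>, both inequalities hold trivially;
    otherwise all terms are real.\<close>
  have "ereal (\<phi> y - \<phi> x) \<le> h y - h x \<longleftrightarrow> ereal (\<phi> y) - h y \<le> ereal (\<phi> x) - h x" for y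
    using assms r unfolding omits_minus_infinity_def by (cases "h y") auto
  then have "(\<forall>y. ereal (\<phi> y - \<phi> x) \<le> h y - h x) \<longleftrightarrow>
      phi_conjugate h \<phi> \<le> ereal (\<phi> x) - h x"
    unfolding phi_conjugate_def by (simp add: SUP_le_iff)
  then show ?thesis
    using True fenchel_young[of \<phi> x h]
    unfolding phi_subdifferential_def effective_domain_def by auto
next
  case False
  then show ?thesis
    unfolding phi_subdifferential_def effective_domain_def by simp
qed

lemma phi_conjugate_nonpos:
  assumes "\<And>y. ereal (\<phi> y) \<le> h y"
  shows "phi_conjugate h \<phi> \<le> 0"
  unfolding phi_conjugate_def
proof (rule SUP_least)
  fix y
  show "ereal (\<phi> y) - h y \<le> 0"
    using assms[of y] by (cases "h y") auto
qed

text \<open>From right to left, subtract the equality for \<open>\<phi>\<close> from the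
  Fenchel-Young inequality for each \<open>\<psi>\<close> at \<open>x\<close>. The other direction
  recovers \<open>h x\<close> from its minorants by \<Phi>-convexity.\<close>

lemma conjugate_subdifferential_iff:
  assumes "omits_minus_infinity h" "proper_function h" "phi_convex \<Phi> h"
  shows "x \<in> conjugate_subdifferential \<Phi> h \<phi> \<longleftrightarrow>
    h x < \<infinity> \<and> phi_conjugate h \<phi> = ereal (\<phi> x) - h x" (is "?L \<longleftrightarrow> ?R")
proof
  assume ?L
  then have fin: "phi_conjugate h \<phi> < \<infinity>"
    and sub: "\<And>\<psi>. \<psi> \<in> \<Phi> \<Longrightarrow>
      ereal (\<psi> x - \<phi> x) \<le> phi_conjugate h \<psi> - phi_conjugate h \<phi>"
    unfolding conjugate_subdifferential_def by auto
  obtain c where c: "phi_conjugate h \<phi> = ereal c"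
    using fin phi_conjugate_not_MInf[OF assms(2), of \<phi>] by (cases "phi_conjugate h \<phi>") auto
  have "h x = (SUP \<psi>\<in>{\<psi>\<in>\<Phi>. \<forall>y. ereal (\<psi> y) \<le> h y}. ereal (\<psi> x))"
    using assms(3) unfolding phi_convex_def by blast
  \<comment> \<open>For a minorant \<open>\<psi>\<close>, \<open>sub\<close> bounds
    \<open>\<psi> x - \<phi> x\<close> by the conjugate at \<open>\<psi>\<close> minus
    \<open>c\<close>, hence by \<open>- c\<close>.\<close>
  also have "\<dots> \<le> ereal (\<phi> x - c)"
  proof (rule SUP_least)
    fix \<psi> assume "\<psi> \<in> {\<psi>\<in>\<Phi>. \<forall>y. ereal (\<psi> y) \<le> h y}"
    then show "ereal (\<psi> x) \<le> ereal (\<phi> x - c)"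
      using sub[of \<psi>] phi_conjugate_nonpos[of \<psi> h] c by (cases "phi_conjugate h \<psi>") auto
  qed
  finally have "h x \<le> ereal (\<phi> x - c)" .
  then show ?R
    using assms(1) c fenchel_young[of \<phi> x h] unfolding omits_minus_infinity_def
    by (cases "h x") auto
next
  assume R: ?R
  then obtain r where r: "h x = ereal r"
    using assms(1) unfolding omits_minus_infinity_def by (cases "h x") auto
  have "ereal (\<psi> x - \<phi> x) \<le> phi_conjugate h \<psi> - phi_conjugate h \<phi>" for \<psi>
    using fenchel_young[of \<psi> x h] R r by (cases "phi_conjugate h \<psi>") auto
  then show ?L
    using R r unfolding conjugate_subdifferential_def by auto
qed

theorem theorem7p3:
  fixes \<Phi> :: "('a::real_vector \<Rightarrow> real) set"
    and f g :: "'a \<Rightarrow> ereal"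
    and xs :: 'a
    and \<phi>s :: "'a \<Rightarrow> real"
  assumes "elementary_functions \<Phi>"
    and "symmetric_functions \<Phi>"
    and "omits_minus_infinity f" and "omits_minus_infinity g"
    and "proper_function f" and "proper_function g"
    and "phi_convex \<Phi> f" and "phi_convex \<Phi> g"
    and "effective_domain f \<inter> effective_domain g \<noteq> {}"
    and "\<phi>s \<in> \<Phi>"
  shows "((INF x. f x + g x) = f xs + g xs \<and>
          f xs + g xs = (SUP \<phi>\<in>\<Phi>. - phi_conjugate f (- \<phi>) - phi_conjugate g \<phi>) \<and>
          (SUP \<phi>\<in>\<Phi>. - phi_conjugate f (- \<phi>) - phi_conjugate g \<phi>)
            = - phi_conjugate f (- \<phi>s) - phi_conjugate g \<phi>s)
         \<longleftrightarrow>
         (- \<phi>s \<in> phi_subdifferential \<Phi> f xs \<and> xs \<in> conjugate_subdifferential \<Phi> g \<phi>s)"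
proof -
  let ?d = "\<lambda>\<phi>. - phi_conjugate f (- \<phi>) - phi_conjugate g \<phi>"
  have wd: "?d \<phi> \<le> f x + g x" for \<phi> x
    using assms by (intro weak_duality)
  have nf: "f xs \<noteq> -\<infinity>" and ng: "g xs \<noteq> -\<infinity>"
    using assms unfolding omits_minus_infinity_def by auto
  have cf: "phi_conjugate f (- \<phi>s) \<noteq> -\<infinity>" and cg: "phi_conjugate g \<phi>s \<noteq> -\<infinity>"
    using assms by (simp_all add: phi_conjugate_not_MInf)
  have yf: "ereal (- \<phi>s xs) - f xs \<le> phi_conjugate f (- \<phi>s)"
    using fenchel_young[of "- \<phi>s" xs f] by simp
  note yg = fenchel_young[of \<phi>s xs g]
  have "- \<phi>s \<in> \<Phi>"
    using assms unfolding symmetric_functions_def by blast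
  then have "(- \<phi>s \<in> phi_subdifferential \<Phi> f xs \<and> xs \<in> conjugate_subdifferential \<Phi> g \<phi>s)
      \<longleftrightarrow> (f xs < \<infinity> \<and> phi_conjugate f (- \<phi>s) = ereal (- \<phi>s xs) - f xs) \<and>
        (g xs < \<infinity> \<and> phi_conjugate g \<phi>s = ereal (\<phi>s xs) - g xs)"
    using assms by (simp add: phi_subdifferential_iff conjugate_subdifferential_iff)
  \<comment> \<open>By \<open>yf\<close> and \<open>yg\<close> both Fenchel-Young gaps are
    nonnegative, so their sum vanishes exactly when each does.\<close>
  also have "\<dots> \<longleftrightarrow> f xs + g xs < \<infinity> \<and> f xs + g xs = ?d \<phi>s"
    using nf ng cf cg yf yg
    by (cases "f xs"; cases "g xs"; cases "phi_conjugate f (- \<phi>s)"; cases "phi_conjugate g \<phi>s")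
      auto
  also have "\<dots> \<longleftrightarrow> (INF x. f x + g x) = f xs + g xs \<and>
      f xs + g xs = (SUP \<phi>\<in>\<Phi>. ?d \<phi>) \<and> (SUP \<phi>\<in>\<Phi>. ?d \<phi>) = ?d \<phi>s"
  proof
    assume "f xs + g xs < \<infinity> \<and> f xs + g xs = ?d \<phi>s"
    then have eq: "f xs + g xs = ?d \<phi>s" ..
    \<comment> \<open>By weak duality the common value \<open>?d \<phi>s\<close> is a lower bound of
      all primal values and an upper bound of all dual ones, and it is attained on both
      sides.\<close>
    have "(INF x. f x + g x) = f xs + g xs"
      by (rule antisym[OF INF_lower INF_greatest]) (simp_all add: eq wd)
    moreover have "(SUP \<phi>\<in>\<Phi>. ?d \<phi>) = ?d \<phi>s"
      by (rule antisym[OF SUP_least SUP_upper])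
        (simp_all add: eq[symmetric] wd \<open>\<phi>s \<in> \<Phi>\<close>)
    ultimately show "(INF x. f x + g x) = f xs + g xs \<and>
        f xs + g xs = (SUP \<phi>\<in>\<Phi>. ?d \<phi>) \<and> (SUP \<phi>\<in>\<Phi>. ?d \<phi>) = ?d \<phi>s"
      using eq by simp
  next
    assume R: "(INF x. f x + g x) = f xs + g xs \<and>
      f xs + g xs = (SUP \<phi>\<in>\<Phi>. ?d \<phi>) \<and> (SUP \<phi>\<in>\<Phi>. ?d \<phi>) = ?d \<phi>s"
    \<comment> \<open>A common point of the domains keeps the infimum, and with it
      \<open>f xs + g xs\<close>, below \<infinity>.\<close>
    obtain z where "f z < \<infinity>" "g z < \<infinity>"
      using assms unfolding effective_domain_def by blast
    then have "f z + g z < \<infinity>" by auto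
    moreover have "(INF x. f x + g x) \<le> f z + g z"
      by (rule INF_lower) simp
    ultimately show "f xs + g xs < \<infinity> \<and> f xs + g xs = ?d \<phi>s"
      using R by auto
  qed
  finally show ?thesis by (rule sym)
qed

end
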